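(* Let $|q|<1$, $k\ge1$, $\alpha_1,\ldots,\alpha_k\in\mathbb{C}$, and suppose $\max\{|a|,|c|,|x_1|,|y_1|,\ldots,|x_k|,|y_k|\}<1$. Then \[ \sum_{n_1,\ldots,n_k=0}^\infty\frac{(a;q)_{n_1+\cdots+n_k}\,\Phi^{(\alpha_1)}_{n_1}(x_1,y_1|q)\cdots\Phi^{(\alpha_k)}_{n_k}(x_k,y_k|q)}{(c;q)_{n_1+\cdots+n_k}(q;q)_{n_1}\cdots(q;q)_{n_k}} =\frac{(a,\alpha_1x_1,\ldots,\alpha_kx_k;q)_\infty}{(c,x_1,y_1,\ldots,x_k,y_k;q)_\infty}\,{}_{2k+1}\phi_{2k}\!\left({{c/a,\ x_1,\ y_1,\ \ldots,\ x_k,\ y_k}\atop{\alpha_1x_1,\ \ldots,\ \alpha_kx_k,\ 0,\ \ldots,\ 0}};q,a\right), \] where the lower parameters of the ${}_{2k+1}\phi_{2k}$ consist of $\alpha_1x_1,\ldots,\alpha_kx_k$ followed by $k$ zeros.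
   Context: $(a;q)_n=\prod_{j=0}^{n-1}(1-aq^j)$, $(a;q)_\infty=\prod_{j\ge0}(1-aq^j)$, $(a_1,\ldots,a_m;q)_n=(a_1;q)_n\cdots(a_m;q)_n$; ${n\brack j}_q=\frac{(q;q)_n}{(q;q)_j(q;q)_{n-j}}$. The homogeneous Hahn polynomials are $\Phi^{(\alpha)}_n(x,y|q)=\sum_{j=0}^n{n\brack j}_q(\alpha;q)_jx^jy^{n-j}$. The basic hypergeometric series is ${}_{r}\phi_{r-1}\!\left({{a_1,\ldots,a_r}\atop{b_1,\ldots,b_{r-1}}};q,z\right)=\sum_{n=0}^\infty\frac{(a_1,\ldots,a_r;q)_n}{(q,b_1,\ldots,b_{r-1};q)_n}z^n$. *)

theory Defs
  imports "HOL-Analysis.Analysis"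
begin

definition qpoch :: "complex \<Rightarrow> complex \<Rightarrow> nat \<Rightarrow> complex" where
  "qpoch a q n = (\<Prod>j<n. 1 - a * q ^ j)"

text \<open>The library product allows vanishing factors: if some factor is zero and the
  remaining ones have a convergent product, its value is 0. For \<open>norm q < 1\<close> it always converges.\<close>

definition qpoch_inf :: "complex \<Rightarrow> complex \<Rightarrow> complex" where
  "qpoch_inf a q = (\<Prod>j. 1 - a * q ^ j)"

definition qpochs :: "complex list \<Rightarrow> complex \<Rightarrow> nat \<Rightarrow> complex" where
  "qpochs as q n = (\<Prod>a\<leftarrow>as. qpoch a q n)"

definition qpochs_inf :: "complex list \<Rightarrow> complex \<Rightarrow> complex" where
  "qpochs_inf as q = (\<Prod>a\<leftarrow>as. qpoch_inf a q)"

definition qbinom :: "complex \<Rightarrow> nat \<Rightarrow> nat \<Rightarrow> complex" where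
  "qbinom q n j = qpoch q q n / (qpoch q q j * qpoch q q (n - j))"

definition hahn_poly :: "complex \<Rightarrow> nat \<Rightarrow> complex \<Rightarrow> complex \<Rightarrow> complex \<Rightarrow> complex" where
  "hahn_poly \<alpha> n x y q = (\<Sum>j\<le>n. qbinom q n j * qpoch \<alpha> q j * x ^ j * y ^ (n - j))"

text \<open>The series with upper parameters \<open>as\<close>, lower parameters \<open>bs\<close>, base \<open>q\<close> and argument \<open>z\<close>,
  meant only for \<open>length as = length bs + 1\<close>: for other lengths the usual definition has an
  additional sign and power of \<open>q\<close> in each term. No \<open>q\<close>-Pochhammer symbol of a lower parameter
  may vanish.\<close>

definition basic_hypergeom :: "complex list \<Rightarrow> complex list \<Rightarrow> complex \<Rightarrow> complex \<Rightarrow> complex" where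
  "basic_hypergeom as bs q z = (\<Sum>n. qpochs as q n / qpochs (q # bs) q n * z ^ n)"

end

theory Submission
  imports Defs
begin

no_notation Infinite_Set_Sum.abs_summable_on (infix \<open>abs'_summable'_on\<close> 50)

text \<open>By the \<open>q\<close>-binomial theorem, the ratio \<open>(a;q)\<^sub>N / (c;q)\<^sub>N\<close> with \<open>N = n\<^sub>1 + \<dots> + n\<^sub>k\<close> equals
  \<open>(a;q)\<^sub>\<infinity> / (c;q)\<^sub>\<infinity>\<close> times the series \<open>\<Sum>\<^sub>m (c/a;q)\<^sub>m / (q;q)\<^sub>m a\<^sup>m q\<^sup>m\<^sup>N\<close>. After this expansion the
  summation over each \<open>n\<^sub>i\<close> decouples, and it is evaluated by the generating function
  \<open>(\<alpha>xt;q)\<^sub>\<infinity> / (xt, yt;q)\<^sub>\<infinity>\<close> of the homogeneous Hahn polynomials at \<open>t = q\<^sup>m\<close>. The interchange of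
  the two summations is justified by absolute convergence.\<close>

section \<open>Infinite \<open>q\<close>-Pochhammer symbols\<close>

lemma qpoch_0_left [simp]: "qpoch 0 q n = 1"
  by (simp add: qpoch_def)

lemma qpoch_inf_0_left [simp]: "qpoch_inf 0 q = 1"
  by (simp add: qpoch_inf_def)

lemma qpoch_0_right [simp]: "qpoch a q 0 = 1"
  by (simp add: qpoch_def)

lemma qpoch_Suc: "qpoch a q (Suc n) = qpoch a q n * (1 - a * q ^ n)"
  by (simp add: qpoch_def)

lemma qpoch_add: "qpoch a q (n + m) = qpoch a q n * qpoch (a * q ^ n) q m"
  by (induction m) (simp_all add: qpoch_Suc power_add mult_ac)

lemma convergent_prod_qpoch:
  fixes a q :: complex
  assumes "norm q < 1"
  shows "convergent_prod (\<lambda>j. 1 - a * q ^ j)"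
proof -
  have "summable (\<lambda>j. norm a * norm q ^ j)"
    using assms by (intro summable_mult summable_geometric) auto
  then have "abs_convergent_prod (\<lambda>j. 1 - a * q ^ j)"
    by (simp add: abs_convergent_prod_conv_summable norm_mult norm_power)
  then show ?thesis
    by (rule abs_convergent_prod_imp_convergent_prod)
qed

lemma tendsto_qpoch_inf:
  assumes "norm q < 1"
  shows "qpoch a q \<longlonglongrightarrow> qpoch_inf a q"
proof -
  \<comment> \<open>The limit of a convergent product is stated for partial products over
    \<open>j \<le> n\<close>, hence the index \<open>Suc n\<close>.\<close>
  have "(\<lambda>n. qpoch a q (Suc n)) \<longlonglongrightarrow> qpoch_inf a q"
    using convergent_prod_LIMSEQ[OF convergent_prod_qpoch[OF assms, of a]]
    by (simp add: qpoch_def qpoch_inf_def lessThan_Suc_atMost)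
  then show ?thesis
    by (rule LIMSEQ_imp_Suc)
qed

lemma qpoch_inf_split:
  assumes "norm q < 1"
  shows "qpoch_inf a q = qpoch a q n * qpoch_inf (a * q ^ n) q"
proof (rule LIMSEQ_unique)
  show "(\<lambda>m. qpoch a q (m + n)) \<longlonglongrightarrow> qpoch_inf a q"
    using tendsto_qpoch_inf[OF assms] by (rule LIMSEQ_ignore_initial_segment)
  show "(\<lambda>m. qpoch a q (m + n)) \<longlonglongrightarrow> qpoch a q n * qpoch_inf (a * q ^ n) q"
    unfolding add.commute[of _ n] qpoch_add
    by (intro tendsto_mult_left tendsto_qpoch_inf assms)
qed

lemma qpoch_inf_nonzero:
  assumes "norm q < 1" "\<And>m. a * q ^ m \<noteq> 1"
  shows "qpoch_inf a q \<noteq> 0"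
  unfolding qpoch_inf_def
  by (rule prodinf_nonzero[OF convergent_prod_qpoch[OF assms(1)]]) (use assms(2) in auto)

text \<open>Supplies the nonvanishing conditions for parameters in the unit disc, including the
  denominators \<open>qpoch q q n\<close>.\<close>

lemma mult_power_neq_1:
  fixes a q :: complex
  assumes "norm q < 1" "norm a < 1"
  shows "a * q ^ m \<noteq> 1"
proof -
  have "norm (a * q ^ m) \<le> norm a"
    using assms by (simp add: norm_mult norm_power mult_left_le power_le_one)
  with assms(2) show ?thesis
    by auto
qed

lemma qpoch_nonzero:
  assumes "\<And>m. a * q ^ m \<noteq> 1"
  shows "qpoch a q n \<noteq> 0"
  using assms by (auto simp: qpoch_def)

text \<open>Turns infinite products at shifted parameters into finite symbols: both the ratio of
  symbols on the left of the final identity and the coefficients of the series on its right arise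
  this way.\<close>

lemma qpoch_inf_shift:
  assumes "norm q < 1" "\<And>m. a * q ^ m \<noteq> 1"
  shows "qpoch_inf (a * q ^ n) q = qpoch_inf a q / qpoch a q n"
  using qpoch_inf_split[OF assms(1), of a n] qpoch_nonzero[OF assms(2), of n]
  by (simp add: field_simps)

section \<open>The \<open>q\<close>-binomial theorem\<close>

text \<open>The coefficients converge, so they are bounded, and a geometric series
  dominates.\<close>

lemma abs_summable_q_binomial:
  assumes "norm q < 1" "norm z < 1"
  shows "summable (\<lambda>n. norm (qpoch a q n / qpoch q q n * z ^ n))"
proof -
  have "(\<lambda>n. qpoch a q n / qpoch q q n) \<longlonglongrightarrow> qpoch_inf a q / qpoch_inf q q"
    by (intro tendsto_divide tendsto_qpoch_inf qpoch_inf_nonzero mult_power_neq_1 assms)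
  then have "Bseq (\<lambda>n. qpoch a q n / qpoch q q n)"
    by (intro convergent_imp_Bseq convergentI)
  then obtain K where K: "\<And>n. norm (qpoch a q n / qpoch q q n) \<le> K"
    by (auto simp: Bseq_def)
  have "summable (\<lambda>n. K * norm z ^ n)"
    using assms by (intro summable_mult summable_geometric) auto
  then show ?thesis
  proof (rule summable_comparison_test')
    show "norm (norm (qpoch a q n / qpoch q q n * z ^ n)) \<le> K * norm z ^ n" for n
      unfolding norm_mult[of _ "z ^ n"] using K[of n]
      by (simp add: norm_mult norm_power mult_right_mono)
  qed
qed

text \<open>A first-order recurrence for the coefficients becomes a functional equation relating
  \<open>F w\<close> to \<open>F (w * q)\<close>. Iterating it drives the argument to 0, where
  \<open>F\<close> is continuous with value 1.\<close>

theorem q_binomial: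
  assumes q: "norm q < 1" and z: "norm z < 1"
  shows "(\<lambda>n. qpoch a q n / qpoch q q n * z ^ n) sums (qpoch_inf (a * z) q / qpoch_inf z q)"
proof -
  define A where "A = (\<lambda>n. qpoch a q n / qpoch q q n)"
  define F where "F = (\<lambda>z. \<Sum>n. A n * z ^ n)"
  have sm: "summable (\<lambda>n. A n * w ^ n)" if "norm w < 1" for w
    using abs_summable_q_binomial[OF q that, of a] unfolding A_def
    by (rule summable_norm_cancel)
  have A_Suc: "A (Suc n) * (1 - q ^ Suc n) = A n * (1 - a * q ^ n)" for n
    using qpoch_nonzero[OF mult_power_neq_1[OF q q], of n] mult_power_neq_1[OF q q, of n]
    by (simp add: A_def qpoch_Suc field_simps)
  have norm_le: "norm (w * q ^ n) < 1" if "norm w < 1" for w n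
  proof -
    have "norm (w * q ^ n) \<le> norm w"
      using q by (simp add: norm_mult norm_power mult_left_le power_le_one)
    then show ?thesis
      using that by simp
  qed
  have fun_eq: "(1 - w) * F w = (1 - a * w) * F (w * q)" if w: "norm w < 1" for w
  proof -
    have wq: "norm (w * q) < 1"
      using norm_le[OF w, of 1] by simp
    have s1: "(\<lambda>n. A n * w ^ n) sums F w"
      and s2: "(\<lambda>n. A n * (w * q) ^ n) sums F (w * q)"
      unfolding F_def by (intro summable_sums sm w wq)+
    have "(\<lambda>n. A n * w ^ n - A n * (w * q) ^ n) sums (F w - F (w * q))"
      by (intro sums_diff s1 s2)
    \<comment> \<open>The terms with index 0 cancel, so the series may start at index 1.\<close>
    then have l: "(\<lambda>n. A (Suc n) * w ^ Suc n - A (Suc n) * (w * q) ^ Suc n) sums (F w - F (w * q))"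
      by (simp add: sums_Suc_iff[where f = "\<lambda>n. A n * w ^ n - A n * (w * q) ^ n"] del: power_Suc)
    have "(\<lambda>n. w * (A n * w ^ n) - a * w * (A n * (w * q) ^ n)) sums (w * F w - a * w * F (w * q))"
      by (intro sums_diff sums_mult s1 s2)
    also have "(\<lambda>n. w * (A n * w ^ n) - a * w * (A n * (w * q) ^ n)) =
        (\<lambda>n. w ^ Suc n * (A n * (1 - a * q ^ n)))"
      by (simp add: algebra_simps power_mult_distrib)
    also have "\<dots> = (\<lambda>n. A (Suc n) * w ^ Suc n - A (Suc n) * (w * q) ^ Suc n)"
      unfolding A_Suc[symmetric] by (simp add: algebra_simps power_mult_distrib)
    finally have "F w - F (w * q) = w * F w - a * w * F (w * q)"
      using l sums_unique2 by blast
    then show ?thesis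
      by (simp add: algebra_simps)
  qed
  have iter: "qpoch z q n * F z = qpoch (a * z) q n * F (z * q ^ n)" for n
  proof (induction n)
    case (Suc n)
    have "qpoch z q (Suc n) * F z = (1 - z * q ^ n) * (qpoch z q n * F z)"
      by (simp add: qpoch_Suc)
    also have "\<dots> = qpoch (a * z) q n * ((1 - z * q ^ n) * F (z * q ^ n))"
      by (simp add: Suc)
    also have "\<dots> = qpoch (a * z) q (Suc n) * F (z * q ^ Suc n)"
      by (subst fun_eq[OF norm_le[OF z]]) (simp add: qpoch_Suc mult_ac)
    finally show ?case .
  qed simp
  have "isCont F 0"
    \<comment> \<open>Any nonzero point of the open unit disc would serve as
      \<open>K\<close>.\<close>
    unfolding F_def by (rule isCont_powser[where K = "1 / 2"]) (simp_all add: sm)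
  moreover have "(\<lambda>n. z * q ^ n) \<longlonglongrightarrow> 0"
    using q by (intro tendsto_mult_right_zero LIMSEQ_power_zero)
  ultimately have "(\<lambda>n. F (z * q ^ n)) \<longlonglongrightarrow> F 0"
    by (rule isCont_tendsto_compose)
  moreover have "F 0 = 1"
    unfolding F_def by (simp only: powser_zero) (simp add: A_def)
  ultimately have "(\<lambda>n. qpoch (a * z) q n * F (z * q ^ n)) \<longlonglongrightarrow> qpoch_inf (a * z) q"
    using tendsto_mult[OF tendsto_qpoch_inf[OF q, of "a * z"]] by fastforce
  moreover have "(\<lambda>n. qpoch z q n * F z) \<longlonglongrightarrow> qpoch_inf z q * F z"
    by (intro tendsto_mult_right tendsto_qpoch_inf q)
  ultimately have "qpoch_inf z q * F z = qpoch_inf (a * z) q"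
    unfolding iter by (rule LIMSEQ_unique[rotated])
  then have "F z = qpoch_inf (a * z) q / qpoch_inf z q"
    using qpoch_inf_nonzero[OF q mult_power_neq_1[OF q z]] by (simp add: field_simps)
  then show ?thesis
    using summable_sums[OF sm[OF z]] by (simp add: F_def A_def)
qed

section \<open>The generating function of the homogeneous Hahn polynomials\<close>

text \<open>The factor \<open>qpoch q q n\<close> of the binomial coefficient cancels. The symbol
  \<open>qpoch 0 q (n - i)\<close>, equal to 1, is written out so that both factors are terms of
  \<open>q\<close>-binomial series, with parameters \<open>\<alpha>\<close> and 0.\<close>

lemma hahn_poly_Cauchy_product:
  assumes "norm q < 1"
  shows "hahn_poly \<alpha> n x y q / qpoch q q n * t ^ n =
    (\<Sum>i\<le>n. qpoch \<alpha> q i / qpoch q q i * (x * t) ^ i *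
            (qpoch 0 q (n - i) / qpoch q q (n - i) * (y * t) ^ (n - i)))"
proof -
  have "qbinom q n i * qpoch \<alpha> q i * x ^ i * y ^ (n - i) / qpoch q q n * t ^ n =
      qpoch \<alpha> q i / qpoch q q i * (x * t) ^ i *
      (qpoch 0 q (n - i) / qpoch q q (n - i) * (y * t) ^ (n - i))" if "i \<le> n" for i
  proof -
    have "t ^ n = t ^ i * t ^ (n - i)"
      using that by (simp flip: power_add)
    then show ?thesis
      using qpoch_nonzero[OF mult_power_neq_1[OF assms assms]]
      by (simp add: qbinom_def power_mult_distrib)
  qed
  then show ?thesis
    by (simp add: hahn_poly_def sum_divide_distrib sum_distrib_right)
qed

lemma abs_summable_hahn_poly:
  assumes q: "norm q < 1" and x: "norm (x * t) < 1" and y: "norm (y * t) < 1"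
  shows "(\<lambda>n. hahn_poly \<alpha> n x y q / qpoch q q n * t ^ n) abs_summable_on UNIV"
proof -
  let ?f = "\<lambda>n. norm (qpoch \<alpha> q n / qpoch q q n * (x * t) ^ n)"
  let ?g = "\<lambda>n. norm (qpoch 0 q n / qpoch q q n * (y * t) ^ n)"
  have "summable (\<lambda>n. \<Sum>i\<le>n. ?f i * ?g (n - i))"
    by (rule summable_Cauchy_product)
      (simp_all only: real_norm_def abs_norm_cancel abs_summable_q_binomial[OF q x] abs_summable_q_binomial[OF q y])
  then have "summable (\<lambda>n. norm (hahn_poly \<alpha> n x y q / qpoch q q n * t ^ n))"
  proof (rule summable_comparison_test')
    show "norm (norm (hahn_poly \<alpha> n x y q / qpoch q q n * t ^ n)) \<le> (\<Sum>i\<le>n. ?f i * ?g (n - i))" for n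
      unfolding hahn_poly_Cauchy_product[OF q] real_norm_def abs_norm_cancel
      by (rule order.trans[OF norm_sum]) (simp only: norm_mult order.refl)
  qed
  then show ?thesis
    by (intro norm_summable_imp_summable_on) simp
qed

theorem hahn_poly_generating_function:
  assumes q: "norm q < 1" and x: "norm (x * t) < 1" and y: "norm (y * t) < 1"
  shows "((\<lambda>n. hahn_poly \<alpha> n x y q / qpoch q q n * t ^ n) has_sum
    (qpoch_inf (\<alpha> * x * t) q / (qpoch_inf (x * t) q * qpoch_inf (y * t) q))) UNIV"
proof -
  have "(\<lambda>n. hahn_poly \<alpha> n x y q / qpoch q q n * t ^ n) sums
    ((\<Sum>n. qpoch \<alpha> q n / qpoch q q n * (x * t) ^ n) * (\<Sum>n. qpoch 0 q n / qpoch q q n * (y * t) ^ n))"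
    unfolding hahn_poly_Cauchy_product[OF q]
    by (intro Cauchy_product_sums abs_summable_q_binomial assms)
  moreover have "(\<Sum>n. qpoch \<alpha> q n / qpoch q q n * (x * t) ^ n) =
      qpoch_inf (\<alpha> * x * t) q / qpoch_inf (x * t) q"
    using q_binomial[OF q x, of \<alpha>] by (simp add: sums_iff mult_ac)
  moreover have "(\<Sum>n. qpoch 0 q n / qpoch q q n * (y * t) ^ n) = 1 / qpoch_inf (y * t) q"
    using q_binomial[OF q y, of 0] by (simp add: sums_iff)
  ultimately have s: "(\<lambda>n. hahn_poly \<alpha> n x y q / qpoch q q n * t ^ n) sums
      (qpoch_inf (\<alpha> * x * t) q / (qpoch_inf (x * t) q * qpoch_inf (y * t) q))"
    by simp
  show ?thesis
    by (rule norm_summable_imp_has_sum[OF summable_on_imp_summable[OF abs_summable_hahn_poly[OF assms]] s])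
qed

section \<open>Absolutely convergent product families\<close>

lemma abs_summable_on_Times_mult:
  fixes f :: "'a \<Rightarrow> 'c :: real_normed_field" and g :: "'b \<Rightarrow> 'c"
  assumes "f abs_summable_on A" "g abs_summable_on B"
  shows "(\<lambda>(x, y). f x * g y) abs_summable_on A \<times> B"
  unfolding Infinite_Sum.abs_summable_on_Sigma_iff
  using assms
  by (auto simp: norm_mult infsum_cmult_right abs_mult intro!: summable_on_cmult_right summable_on_cmult_left)

text \<open>Induction on the index set: choosing a function on \<open>insert x A\<close> amounts to
  choosing its value at \<open>x\<close> and its restriction to \<open>A\<close>.\<close>

lemma abs_summable_on_prod_PiE:
  fixes f :: "'a \<Rightarrow> 'b \<Rightarrow> 'c :: real_normed_field"
  assumes "finite A" "\<And>x. x \<in> A \<Longrightarrow> f x abs_summable_on B x"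
  shows "(\<lambda>g. \<Prod>x\<in>A. f x (g x)) abs_summable_on PiE A B"
  using assms
proof (induction A)
  case (insert x A)
  have bij: "bij_betw (\<lambda>(y, g). g(x := y)) (B x \<times> PiE A B) (PiE (insert x A) B)"
    unfolding bij_betw_def PiE_insert_eq using inj_combinator[OF insert.hyps(2)] by auto
  have eq: "(\<Prod>z\<in>A. f z (if z = x then y else g z)) = (\<Prod>z\<in>A. f z (g z))" for y g
    by (rule prod.cong) (use insert.hyps in auto)
  have "(\<lambda>(y, g). f x y * (\<Prod>z\<in>A. f z (g z))) abs_summable_on B x \<times> PiE A B"
    by (intro abs_summable_on_Times_mult insert) auto
  then have "(\<lambda>p. norm (\<Prod>z\<in>insert x A. f z ((case p of (y, g) \<Rightarrow> g(x := y)) z)))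
      summable_on B x \<times> PiE A B"
    using insert.hyps by (simp add: case_prod_unfold eq)
  then show ?case
    by (subst (asm) summable_on_reindex_bij_betw[OF bij])
qed auto

text \<open>Passes from the parameter lists of the final statement to products over the index
  set.\<close>

lemma prod_list_map_upt:
  "prod_list (map f [1..<k + 1]) = (\<Prod>i\<in>{1..k}. f i :: 'a :: comm_monoid_mult)"
proof -
  have "set [1..<k + 1] = {1..k}"
    by auto
  then show ?thesis
    by (metis distinct_upt prod.distinct_set_conv_list)
qed

lemma prod_list_map_concat_pair:
  "prod_list (map f (concat (map (\<lambda>i. [x i, y i]) is))) =
    (\<Prod>i\<leftarrow>is. f (x i) * f (y i) :: 'a :: comm_monoid_mult)"
  by (induction "is") (simp_all add: mult_ac)

section \<open>The multiple sum\<close>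

text \<open>The multiple series is an unconditional sum over all index tuples. The last two
  assumptions give meaning to the right-hand side: \<open>c / a\<close> is a genuine quotient and no
  symbol of a lower parameter vanishes.\<close>

theorem theorem6p1:
  fixes q a c :: complex and k :: nat and \<alpha> x y :: "nat \<Rightarrow> complex"
  assumes "norm q < 1" and "k \<ge> 1"
    and "norm a < 1" and "norm c < 1"
    and "\<And>i. i \<in> {1..k} \<Longrightarrow> norm (x i) < 1"
    and "\<And>i. i \<in> {1..k} \<Longrightarrow> norm (y i) < 1"
    and "a \<noteq> 0"
    and "\<And>i m. i \<in> {1..k} \<Longrightarrow> \<alpha> i * x i * q ^ m \<noteq> 1"
  shows "((\<lambda>n. qpoch a q (\<Sum>i\<in>{1..k}. n i) * (\<Prod>i\<in>{1..k}. hahn_poly (\<alpha> i) (n i) (x i) (y i) q)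
              / (qpoch c q (\<Sum>i\<in>{1..k}. n i) * (\<Prod>i\<in>{1..k}. qpoch q q (n i))))
          has_sum
            (qpochs_inf (a # map (\<lambda>i. \<alpha> i * x i) [1..<k+1]) q
              / qpochs_inf (c # concat (map (\<lambda>i. [x i, y i]) [1..<k+1])) q
             * basic_hypergeom
                 (c / a # concat (map (\<lambda>i. [x i, y i]) [1..<k+1]))
                 (map (\<lambda>i. \<alpha> i * x i) [1..<k+1] @ replicate k 0) q a))
         ({1..k} \<rightarrow>\<^sub>E (UNIV :: nat set))"
proof -
  note q = assms(1) and a = assms(3) and c = assms(4) and x = assms(5) and y = assms(6)
    and ax = assms(8)
  let ?I = "{1..k}"
  let ?P = "?I \<rightarrow>\<^sub>E (UNIV :: nat set)"
  define h where "h = (\<lambda>i n. hahn_poly (\<alpha> i) n (x i) (y i) q / qpoch q q n)"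
  define A where "A = (\<lambda>m. qpoch (c / a) q m / qpoch q q m)"
  \<comment> \<open>\<open>G\<close> is the double family to be summed in both orders: over
    \<open>n\<close> first it leads to the right-hand side, over \<open>m\<close> first to the left,
    both up to the factor \<open>qpoch_inf a q / qpoch_inf c q\<close>.\<close>
  define G where "G = (\<lambda>(m, n). A m * a ^ m * (\<Prod>i\<in>?I. h i (n i) * (q ^ m) ^ n i))"
  \<comment> \<open>\<open>C\<close> is the product of the generating functions at
    \<open>t = 1\<close>; \<open>r m\<close> is the factor by which it changes at
    \<open>t = q ^ m\<close>.\<close>
  define C where "C = (\<Prod>i\<in>?I. qpoch_inf (\<alpha> i * x i) q / (qpoch_inf (x i) q * qpoch_inf (y i) q))"
  define r where "r = (\<lambda>m. \<Prod>i\<in>?I. qpoch (x i) q m * qpoch (y i) q m / qpoch (\<alpha> i * x i) q m)"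

  have qm: "norm (q ^ m) \<le> 1" for m
    using q by (simp add: norm_power power_le_one)
  have lt1: "norm (z * q ^ m) < 1" if "norm z < 1" for z m
    using mult_left_le[OF qm[of m], of "norm z"] that by (simp add: norm_mult)

  have Pi_h: "(\<lambda>n. \<Prod>i\<in>?I. h i (n i)) abs_summable_on ?P"
    by (rule abs_summable_on_prod_PiE)
      (use abs_summable_hahn_poly[OF q, where t = 1] x y in \<open>auto simp: h_def\<close>)
  have "(\<lambda>m. A m * a ^ m) abs_summable_on UNIV"
    using abs_summable_q_binomial[OF q a, of "c / a"] unfolding A_def
    by (intro norm_summable_imp_summable_on) simp
  then have "(\<lambda>(m, n). A m * a ^ m * (\<Prod>i\<in>?I. h i (n i))) abs_summable_on UNIV \<times> ?P"
    by (rule abs_summable_on_Times_mult[OF _ Pi_h])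
  \<comment> \<open>As \<open>norm (q ^ m) \<le> 1\<close>, the case \<open>t = 1\<close> dominates
    the inner products for every \<open>m\<close>.\<close>
  then have "G abs_summable_on UNIV \<times> ?P"
  proof (rule Infinite_Sum.abs_summable_on_comparison_test, clarify)
    fix m and n :: "nat \<Rightarrow> nat"
    have "norm (\<Prod>i\<in>?I. h i (n i) * (q ^ m) ^ n i) \<le> norm (\<Prod>i\<in>?I. h i (n i))"
      unfolding prod_norm[symmetric] norm_mult norm_power[of "q ^ m"] using qm
      by (intro prod_mono) (auto intro!: mult_left_le power_le_one)
    then show "norm (G (m, n)) \<le> norm (A m * a ^ m * (\<Prod>i\<in>?I. h i (n i)))"
      by (simp add: G_def norm_mult mult_left_mono)
  qed
  then obtain T where T: "(G has_sum T) (UNIV \<times> ?P)"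
    using abs_summable_summable has_sum_infsum by blast

  have inner_n: "((\<lambda>n. G (m, n)) has_sum (A m * a ^ m * (C * r m))) ?P" for m
  proof -
    have gf: "((\<lambda>n. h i n * (q ^ m) ^ n) has_sum (qpoch_inf (\<alpha> i * x i) q / (qpoch_inf (x i) q * qpoch_inf (y i) q) *
        (qpoch (x i) q m * qpoch (y i) q m / qpoch (\<alpha> i * x i) q m))) UNIV" if i: "i \<in> ?I" for i
      using hahn_poly_generating_function[OF q lt1[OF x[OF i], of m] lt1[OF y[OF i], of m], of "\<alpha> i"]
      unfolding qpoch_inf_shift[OF q ax[OF i]]
        qpoch_inf_shift[OF q mult_power_neq_1[OF q x[OF i]]]
        qpoch_inf_shift[OF q mult_power_neq_1[OF q y[OF i]]]
      by (simp add: h_def mult_ac)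
    have abs: "(\<lambda>n. h i n * (q ^ m) ^ n) abs_summable_on UNIV" if i: "i \<in> ?I" for i
      unfolding h_def by (intro abs_summable_hahn_poly q lt1 x y i)
    have "(\<lambda>n. \<Prod>i\<in>?I. h i (n i) * (q ^ m) ^ n i) summable_on ?P"
      by (rule abs_summable_summable, rule abs_summable_on_prod_PiE) (use abs in auto)
    \<comment> \<open>For fixed \<open>m\<close> the variables separate, so the multiple sum is a
      product of single sums.\<close>
    moreover have "infsum (\<lambda>n. \<Prod>i\<in>?I. h i (n i) * (q ^ m) ^ n i) ?P =
        (\<Prod>i\<in>?I. infsum (\<lambda>n. h i n * (q ^ m) ^ n) UNIV)"
      by (rule infsum_prod_PiE_abs) (use abs in auto)
    moreover have "\<dots> = C * r m"
      unfolding C_def r_def prod.distrib[symmetric] by (rule prod.cong[OF refl infsumI[OF gf]])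
    ultimately have "((\<lambda>n. \<Prod>i\<in>?I. h i (n i) * (q ^ m) ^ n i) has_sum (C * r m)) ?P"
      unfolding has_sum_iff by (simp only:)
    then show ?thesis
      unfolding G_def by (auto intro: has_sum_cmult_right)
  qed
  have "((\<lambda>m. A m * a ^ m * (C * r m)) has_sum T) UNIV"
    by (rule has_sum_SigmaD[OF T inner_n])
  then have "(\<lambda>m. A m * a ^ m * (C * r m) / C) sums (T / C)"
    by (intro sums_divide has_sum_imp_sums)
  \<comment> \<open>The numerators are nonzero by the assumption on \<open>\<alpha> i * x i\<close>,
    the denominators because \<open>x i\<close> and \<open>y i\<close> lie in the unit disc.\<close>
  moreover have C0: "C \<noteq> 0"
    unfolding C_def using q x y ax by (auto simp: qpoch_inf_nonzero mult_power_neq_1)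
  then have "A m * a ^ m * (C * r m) / C = A m * r m * a ^ m" for m
    by simp
  ultimately have series: "(\<lambda>m. A m * r m * a ^ m) sums (T / C)"
    by (simp only:)
  have "qpochs (c / a # concat (map (\<lambda>i. [x i, y i]) [1..<k+1])) q m =
      qpoch (c / a) q m * (\<Prod>i\<in>?I. qpoch (x i) q m * qpoch (y i) q m)" for m
    unfolding qpochs_def list.map prod_list.Cons prod_list_map_concat_pair prod_list_map_upt
    by (rule refl)
  \<comment> \<open>Each of the \<open>k\<close> zero parameters contributes a factor 1.\<close>
  moreover have "qpochs (q # map (\<lambda>i. \<alpha> i * x i) [1..<k+1] @ replicate k 0) q m =
      qpoch q q m * (\<Prod>i\<in>?I. qpoch (\<alpha> i * x i) q m)" for m
    unfolding qpochs_def list.map prod_list.Cons map_append prod_list.append map_map comp_def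
      prod_list_map_upt map_replicate qpoch_0_left
    by simp
  ultimately have "basic_hypergeom (c / a # concat (map (\<lambda>i. [x i, y i]) [1..<k+1]))
      (map (\<lambda>i. \<alpha> i * x i) [1..<k+1] @ replicate k 0) q a = T / C"
    unfolding basic_hypergeom_def sums_unique[OF series]
    by (simp only: A_def r_def prod_dividef times_divide_times_eq)
  moreover have "qpochs_inf (a # map (\<lambda>i. \<alpha> i * x i) [1..<k+1]) q
              / qpochs_inf (c # concat (map (\<lambda>i. [x i, y i]) [1..<k+1])) q
              = qpoch_inf a q / qpoch_inf c q * C"
    unfolding qpochs_inf_def list.map prod_list.Cons 
      prod_list_map_concat_pair map_map comp_def prod_list_map_upt C_def
    by (simp add: prod_dividef)
  ultimately have rhs: "qpochs_inf (a # map (\<lambda>i. \<alpha> i * x i) [1..<k+1]) q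
              / qpochs_inf (c # concat (map (\<lambda>i. [x i, y i]) [1..<k+1])) q
             * basic_hypergeom
                 (c / a # concat (map (\<lambda>i. [x i, y i]) [1..<k+1]))
                 (map (\<lambda>i. \<alpha> i * x i) [1..<k+1] @ replicate k 0) q a
             = qpoch_inf a q / qpoch_inf c q * T"
    using C0 by simp

  have inner_m: "((\<lambda>m. G (m, n)) has_sum
      ((\<Prod>i\<in>?I. h i (n i)) * (qpoch_inf (c * q ^ sum n ?I) q / qpoch_inf (a * q ^ sum n ?I) q))) UNIV"
    for n
  proof -
    let ?z = "a * q ^ sum n ?I"
    have z: "norm ?z < 1"
      by (rule lt1[OF a])
    \<comment> \<open>Parameter times argument is \<open>c * q ^ sum n ?I\<close>, because
      \<open>a\<close> is nonzero.\<close>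
    have "(\<lambda>m. A m * ?z ^ m) sums (qpoch_inf (c / a * ?z) q / qpoch_inf ?z q)"
      unfolding A_def by (rule q_binomial[OF q z])
    then have "((\<lambda>m. A m * ?z ^ m) has_sum (qpoch_inf (c * q ^ sum n ?I) q / qpoch_inf ?z q)) UNIV"
      using abs_summable_q_binomial[OF q z, of "c / a"] \<open>a \<noteq> 0\<close>
      by (intro norm_summable_imp_has_sum) (simp_all add: A_def)
    moreover have "G (m, n) = (\<Prod>i\<in>?I. h i (n i)) * (A m * ?z ^ m)" for m
    proof -
      \<comment> \<open>The powers of \<open>q\<close> see the tuple only through its sum, which
        makes the sum over \<open>m\<close> a single \<open>q\<close>-binomial series.\<close>
      have "(\<Prod>i\<in>?I. (q ^ m) ^ n i) = (q ^ sum n ?I) ^ m"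
        by (simp only: power_sum prod_power_distrib power_commutes flip: power_mult)
          (simp add: mult.commute)
      then show ?thesis
        by (simp add: G_def prod.distrib power_mult_distrib mult_ac)
    qed
    ultimately show ?thesis
      by (simp only: has_sum_cmult_right)
  qed
  \<comment> \<open>The same total \<open>T\<close> is now computed with the roles of
    \<open>m\<close> and \<open>n\<close> exchanged.\<close>
  have "((\<lambda>n. (\<Prod>i\<in>?I. h i (n i)) * (qpoch_inf (c * q ^ sum n ?I) q / qpoch_inf (a * q ^ sum n ?I) q))
      has_sum T) ?P"
    by (rule has_sum_SigmaD[where f = "\<lambda>(n, m). G (m, n)" and B = "\<lambda>_. UNIV"])
      (use T inner_m in \<open>simp_all add: has_sum_swap[of G]\<close>)
  then have "((\<lambda>n. qpoch_inf a q / qpoch_inf c q * ((\<Prod>i\<in>?I. h i (n i)) *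
      (qpoch_inf (c * q ^ sum n ?I) q / qpoch_inf (a * q ^ sum n ?I) q)))
      has_sum (qpoch_inf a q / qpoch_inf c q * T)) ?P"
    by (rule has_sum_cmult_right)
  also have "(\<lambda>n. qpoch_inf a q / qpoch_inf c q * ((\<Prod>i\<in>?I. h i (n i)) *
      (qpoch_inf (c * q ^ sum n ?I) q / qpoch_inf (a * q ^ sum n ?I) q))) =
      (\<lambda>n. qpoch a q (sum n ?I) * (\<Prod>i\<in>?I. hahn_poly (\<alpha> i) (n i) (x i) (y i) q)
              / (qpoch c q (sum n ?I) * (\<Prod>i\<in>?I. qpoch q q (n i))))"
    using qpoch_inf_nonzero[OF q mult_power_neq_1[OF q a]]
      qpoch_inf_nonzero[OF q mult_power_neq_1[OF q c]]
    by (simp add: qpoch_inf_shift[OF q mult_power_neq_1[OF q a]]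
        qpoch_inf_shift[OF q mult_power_neq_1[OF q c]] h_def prod_dividef mult.commute)
  finally show ?thesis
    unfolding rhs .
qed

end
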